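(* Let $A$ be a unital associative ring. Let $m, n$ be positive integers and suppose that at least one of $m, n$ is odd. Then, for all $a_1,\dots,a_m, b_1,\dots,b_n \in A$, \[ 3\,[a_1, \dots , a_m]\,[b_1, \dots , b_n] \in T^{(m+n-1)}. \]
   Context: $A$ is a (not necessarily commutative) unital associative ring. Left-normed commutators are defined recursively by $[a_1]=a_1$, $[a_1,a_2]=a_1a_2-a_2a_1$, and $[a_1,\dots,a_{k-1},a_k]=\bigl[[a_1,\dots,a_{k-1}],a_k\bigr]$ for $k>2$. For $k\ge 1$, $T^{(k)}=T^{(k)}(A)$ denotes the two-sided ideal of $A$ generated by all commutators $[a_1,\dots,a_k]$ with $a_i\in A$; in particular $T^{(1)}=A$. *)

theory Defs
  imports "HOL-Algebra.Algebra"
begin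

definition commutator :: "('a, 'b) ring_scheme \<Rightarrow> 'a \<Rightarrow> 'a \<Rightarrow> 'a" where
  "commutator R x y = x \<otimes>\<^bsub>R\<^esub> y \<ominus>\<^bsub>R\<^esub> y \<otimes>\<^bsub>R\<^esub> x"

(* left_normed R a k is [a 1, ..., a k], with indices starting at 1.
   The value at k = 0 is a dummy: the commutator is defined only for k \<ge> 1. *)
fun left_normed :: "('a, 'b) ring_scheme \<Rightarrow> (nat \<Rightarrow> 'a) \<Rightarrow> nat \<Rightarrow> 'a" where
  "left_normed R a 0 = \<zero>\<^bsub>R\<^esub>"
| "left_normed R a (Suc 0) = a 1"
| "left_normed R a (Suc (Suc k)) = commutator R (left_normed R a (Suc k)) (a (Suc (Suc k)))"

(* Ideals of HOL-Algebra are two-sided, so Idl gives the two-sided ideal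
   generated by a set. Only k \<ge> 1 is meaningful. *)
definition T_ideal :: "('a, 'b) ring_scheme \<Rightarrow> nat \<Rightarrow> 'a set" where
  "T_ideal R k = Idl\<^bsub>R\<^esub> {left_normed R a k | a. a \<in> {1..k} \<rightarrow> carrier R}"

lemma (in ring) T_ideal_1: "T_ideal R 1 = carrier R"
proof -
  have "{left_normed R a 1 | a. a \<in> {1..1} \<rightarrow> carrier R} = carrier R"
    (is "?S = _")
  proof
    show "?S \<subseteq> carrier R"
      by auto
    show "carrier R \<subseteq> ?S"
    proof
      fix x assume "x \<in> carrier R"
      then show "x \<in> ?S"
        by (intro CollectI exI[of _ "\<lambda>_. x"]) auto
    qed
  qed
  then show ?thesis
    unfolding T_ideal_def
    using genideal_self[of "carrier R"] ideal.Icarr[OF genideal_ideal[of "carrier R"]]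
    by auto
qed

end

theory Submission
  imports Defs
begin

text \<open>Let \<open>L\<^sub>k\<close> be the additive group spanned by the commutators of length \<open>k\<close>. The main step is
  \<open>3 [A L\<^sub>k, A] \<subseteq> L\<^bsub>k+1\<^esub>\<close> for odd \<open>k\<close>. It yields \<open>3 [A L\<^sub>k, L\<^sub>j] \<subseteq> L\<^bsub>k+j\<^esub>\<close> by the Jacobi identity, and
  then the theorem, because \<open>[c, x] l = x [l, c] - [x l, c]\<close> for \<open>l \<in> L\<^sub>k\<close>, \<open>c \<in> L\<^bsub>n-1\<^esub>\<close>.

  The main step rests on the elements \<open>F(a,b,c,d,e) = [[a,b,c] d, e]\<close>. Expanding commutators in which
  one entry is a product of two letters shows that, modulo \<open>L\<^sub>4\<close>, \<open>F\<close> changes sign under \<open>c \<leftrightarrow> d\<close> and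
  under \<open>d \<leftrightarrow> e\<close> and is invariant under exchanging \<open>(a,b)\<close> with \<open>(c,d)\<close>. So \<open>F\<close> is alternating, and the
  Jacobi identity gives \<open>3 F = 0\<close>, which is the case \<open>k = 3\<close>. If one letter is taken from \<open>L\<^sub>k\<close>, the
  same relations hold for \<open>3 F\<close> modulo \<open>L\<^bsub>k+3\<^esub>\<close>; moving that letter to the last place, where
  \<open>3 F\<close> vanishes by the case \<open>3\<close>, gives the step from \<open>k\<close> to \<open>k + 2\<close>.\<close>

section \<open>The lower central series of a ring\<close>

definition lie :: "'a::ring \<Rightarrow> 'a \<Rightarrow> 'a" where
  "lie x y = x * y - y * x"

lemma lie_diff_left: "lie (x - y) z = lie x z - lie y z"
  and lie_diff_right: "lie x (y - z) = lie x y - lie x z"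
  and lie_add_left: "lie (x + y) z = lie x z + lie y z"
  and lie_jacobi: "lie x (lie y z) = lie (lie x y) z - lie (lie x z) y"
  by (simp_all add: lie_def algebra_simps)

definition triple :: "'a::ring \<Rightarrow> 'a" where
  "triple x = x + x + x"

lemma triple_diff: "triple (x - y) = triple x - triple y"
  and triple_lie: "triple (lie x y) = lie (triple x) y"
  by (simp_all add: triple_def lie_def algebra_simps)

text \<open>The index is shifted by one: \<open>lcs k\<close> is the additive group spanned by the left-normed
  commutators of length \<open>k + 1\<close>, so odd lengths correspond to even \<open>k\<close>.\<close>

inductive lcs :: "nat \<Rightarrow> 'a::ring \<Rightarrow> bool" where
  base: "lcs 0 x"
| lie: "lcs k x \<Longrightarrow> lcs (Suc k) (lie x y)"
| diff: "lcs k x \<Longrightarrow> lcs k y \<Longrightarrow> lcs k (x - y)"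

lemma lcs_zero: "lcs k (0 :: 'a::ring)"
proof (induction k)
  case (Suc k)
  from lcs.lie[OF Suc, of 0] show ?case by (simp add: lie_def)
qed (rule lcs.base)

lemma lcs_uminus: "lcs k x \<Longrightarrow> lcs k (- x)"
  using lcs.diff[OF lcs_zero, of k x] by simp

lemma lcs_add: "lcs k x \<Longrightarrow> lcs k y \<Longrightarrow> lcs k (x + y)"
  using lcs.diff[OF _ lcs_uminus, of k x y] by simp

lemma lcs_triple: "lcs k x \<Longrightarrow> lcs k (triple x)"
  unfolding triple_def by (intro lcs_add)

text \<open>By the Jacobi identity the last entry of \<open>y\<close> moves over to
  \<open>x\<close>, so the induction on \<open>y\<close> needs \<open>x\<close> arbitrary.\<close>

lemma lcs_lie:
  assumes "lcs i x" and "lcs k y"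
  shows "lcs (Suc (i + k)) (lie x y)"
  using assms(2,1)
proof (induction arbitrary: i x)
  case (base y)
  then show ?case by (simp add: lcs.lie)
next
  case (lie k y z)
  have "lcs (Suc (Suc (i + k))) (lie (lie x y) z)"
    using lie.IH[OF lie.prems] by (rule lcs.lie)
  moreover have "lcs (Suc (Suc (i + k))) (lie (lie x z) y)"
    using lie.IH[OF lcs.lie[OF lie.prems]] by simp
  ultimately show ?case
    unfolding lie_jacobi by (simp add: lcs.diff)
next
  case (diff k y z)
  then show ?case by (simp add: lie_diff_right lcs.diff)
qed

lemma lcs_lie_swap: "lcs i x \<Longrightarrow> lcs k y \<Longrightarrow> lcs (Suc (i + k)) (lie y x)"
  using lcs_lie[of k y i x] by (simp add: add.commute)

section \<open>Commutators with one product among five letters\<close>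

text \<open>Modulo \<open>M\<close>, the elements \<open>[[a, b, c] d, e]\<close> turn out to be antisymmetric under enough
  transpositions of letters to determine them up to sign. The predicate \<open>Q\<close> only serves to
  restrict which letters may be substituted.\<close>

locale five_letters =
  fixes M :: "'a::ring \<Rightarrow> bool" and Q :: "'a \<Rightarrow> 'a \<Rightarrow> 'a \<Rightarrow> 'a \<Rightarrow> 'a \<Rightarrow> bool"
  assumes diff: "M u \<Longrightarrow> M v \<Longrightarrow> M (u - v)"
    and swap12: "Q a b c d e \<Longrightarrow> Q b a c d e"
    and swap23: "Q a b c d e \<Longrightarrow> Q a c b d e"
    and swap34: "Q a b c d e \<Longrightarrow> Q a b d c e"
    and swap45: "Q a b c d e \<Longrightarrow> Q a b c e d"
    and product1: "Q a b c d e \<Longrightarrow> M (lie (lie (lie (a * b) c) d) e)"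
    and product3: "Q a b c d e \<Longrightarrow> M (lie (lie (lie a b) (c * d)) e)"
    and product4: "Q a b c d e \<Longrightarrow> M (lie (lie (lie a b) c) (d * e))"
begin

definition F :: "'a \<Rightarrow> 'a \<Rightarrow> 'a \<Rightarrow> 'a \<Rightarrow> 'a \<Rightarrow> 'a" where
  "F a b c d e = lie (lie (lie a b) c * d) e"

lemma add: assumes "M u" and "M v" shows "M (u + v)"
proof -
  have "M (u - (v - v - v))"
    using assms by (intro diff)
  then show ?thesis by simp
qed

lemma left_normed_5:
  assumes "Q a b c d e"
  shows "M (lie (lie (lie (lie a b) c) d) e)"
proof -
  have "M (lie (lie (lie (a * b) c) d) e - lie (lie (lie (b * a) c) d) e)"
    by (intro diff product1 assms swap12[OF assms])
  then show ?thesis by (simp add: lie_def[of a b] lie_diff_left)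
qed

text \<open>Leibniz rule for \<open>[[a, b], c * d]\<close>: its term \<open>c * [a, b, d]\<close>
  differs from \<open>[a, b, d] * c\<close> only by a longer commutator.\<close>

lemma F_swap34:
  assumes "Q a b c d e"
  shows "M (F a b c d e + F a b d c e)"
proof -
  have "F a b c d e + F a b d c e
      = lie (lie (lie a b) (c * d)) e + lie (lie (lie (lie a b) d) c) e"
    unfolding F_def by (simp add: lie_def algebra_simps)
  then show ?thesis
    using assms by (simp add: add product3 left_normed_5[OF swap34])
qed

lemma F_swap45:
  assumes "Q a b c d e"
  shows "M (F a b c d e + F a b c e d)"
proof -
  have "F a b c d e + F a b c e d
      = lie (lie (lie a b) c) (e * d) + lie (lie (lie (lie a b) c) d) e"
    unfolding F_def lie_def[of _ d] lie_def[of _ e] lie_def[of _ "e * d"]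
    by (simp add: algebra_simps)
  then show ?thesis
    using assms by (simp add: add product4[OF swap45] left_normed_5)
qed

lemma F_swap_pairs:
  assumes "Q a b c d e"
  shows "M (F a b c d e - F c d a b e)"
proof -
  \<comment> \<open>Expand the right side by the Leibniz rule: products of \<open>[a, b]\<close> and
    \<open>[c, d]\<close> cancel, those of \<open>[b, c]\<close> and \<open>[a, d]\<close> leave
    \<open>[[b, c], [a, d]]\<close>, which the Jacobi identity removes.\<close>
  have "lie (lie a b) c * d - lie (lie c d) a * b
      = lie (lie a b) (c * d) + lie (lie (d * b) c) a
        - lie (lie b c) (a * d) - lie (lie (c * a) b) d"
    by (simp add: lie_def algebra_simps)
  then have "F a b c d e - F c d a b e
      = lie (lie (lie a b) (c * d)) e + lie (lie (lie (d * b) c) a) e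
        - lie (lie (lie b c) (a * d)) e - lie (lie (lie (c * a) b) d) e"
    unfolding F_def lie_diff_left[symmetric] lie_add_left[symmetric] by simp
  moreover have "Q d b c a e" "Q b c a d e" "Q c a b d e"
    using assms by (meson swap12 swap23 swap34)+
  ultimately show ?thesis
    using assms by (simp add: add diff product1 product3)
qed

lemma F_swap12: "F b a c d e = - F a b c d e"
  unfolding F_def by (simp add: lie_def algebra_simps)

lemma F_jacobi: "F a b c d e + F b c a d e + F c a b d e = 0"
  unfolding F_def by (simp add: lie_def algebra_simps)

text \<open>Serves the induction on the length: the distinguished letter leaves the triple
  commutator for the last place.\<close>

lemma F_move_first_last:
  assumes "Q a b c d e"
  shows "M (F a b c d e - F c d b e a)"
proof -
  have "Q c d a b e" "Q c d b a e"
    using assms by (meson swap12 swap23 swap34)+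
  then have "M (F a b c d e - F c d a b e + (F c d a b e + F c d b a e)
      - (F c d b a e + F c d b e a))"
    using assms by (intro add diff F_swap_pairs F_swap34 F_swap45)
  then show ?thesis by simp
qed

text \<open>The exchange of pairs takes place 2 to place 4, so it conjugates the transposition (4 5)
  into (2 5). Further conjugations give (2 4) and then (2 3).\<close>

lemma F_swap25:
  assumes "Q a b c d e"
  shows "M (F a b c d e + F a e c d b)"
proof -
  have "Q c d a b e" "Q c d a e b" "Q a e c d b"
    using assms by (meson swap12 swap23 swap34 swap45)+
  then have "M (F a b c d e - F c d a b e + (F c d a b e + F c d a e b)
      + (F a e c d b - F c d a e b))"
    using assms by (intro add F_swap_pairs F_swap45)
  then show ?thesis by simp
qed

lemma F_swap24:
  assumes "Q a b c d e"
  shows "M (F a b c d e + F a d c b e)"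
proof -
  have "Q a e c d b" "Q a e c b d"
    using assms by (meson swap12 swap23 swap34 swap45)+
  then have "M (F a b c d e + F a e c d b - (F a e c d b + F a e c b d)
      + (F a e c b d + F a d c b e))"
    using assms by (intro add diff F_swap25 F_swap45)
  then show ?thesis by simp
qed

lemma F_swap23:
  assumes "Q a b c d e"
  shows "M (F a b c d e + F a c b d e)"
proof -
  have "Q a b d c e" "Q a c d b e"
    using assms by (meson swap23 swap34)+
  then have "M (F a b c d e + F a b d c e - (F a b d c e + F a c d b e)
      + (F a c d b e + F a c b d e))"
    using assms by (intro add diff F_swap34 F_swap24)
  then show ?thesis by simp
qed

text \<open>By antisymmetry all three terms of the Jacobi identity agree.\<close>

lemma F_triple:
  assumes "Q a b c d e"
  shows "M (triple (F a b c d e))"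
proof -
  have "Q c b a d e"
    using assms by (meson swap12 swap23)
  then have "M (F a b c d e + F a c b d e + (F c b a d e + F c a b d e)
      + (F a b c d e + F a c b d e))"
    using assms by (intro add F_swap23)
  moreover have "F b c a d e = - F a b c d e - F c a b d e"
    using F_jacobi[of a b c d e] by (simp add: algebra_simps eq_neg_iff_add_eq_0)
  ultimately show ?thesis
    by (simp add: triple_def F_swap12[of c a] F_swap12[of b c] algebra_simps)
qed

end

section \<open>Triple products with an element of odd length\<close>

lemma lcs_Suc_induct [consumes 1, case_names lie diff]:
  assumes "lcs (Suc k) u"
    and "\<And>x y. lcs k x \<Longrightarrow> P (lie x y)"
    and "\<And>u v. P u \<Longrightarrow> P v \<Longrightarrow> P (u - v)"
  shows "P u"
  using assms(1)
proof (induction "Suc k" u rule: lcs.induct)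
  case (lie x y)
  then show ?case by (intro assms(2)) simp
next
  case (diff x y)
  then show ?case by (intro assms(3)) simp_all
qed

lemma lcs_Suc_Suc_induct [consumes 1, case_names lie diff]:
  assumes "lcs (Suc (Suc k)) u"
    and "\<And>x y z. lcs k x \<Longrightarrow> P (lie (lie x y) z)"
    and "\<And>u v. P u \<Longrightarrow> P v \<Longrightarrow> P (u - v)"
  shows "P u"
  using assms(1)
proof (induction rule: lcs_Suc_induct)
  case (lie x z)
  then show ?case
  proof (induction rule: lcs_Suc_induct)
    case (lie x y)
    then show ?case by (rule assms(2))
  next
    case (diff u v)
    then show ?case unfolding lie_diff_left by (rule assms(3))
  qed
next
  case (diff u v)
  then show ?case by (rule assms(3))
qed

lemma lcs_lie_same: "lcs k x \<Longrightarrow> lcs k (lie x y)"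
proof (induction arbitrary: y rule: lcs.induct)
  case (base x)
  show ?case by (rule lcs.base)
next
  case (lie k x z)
  show ?case using lie.IH by (rule lcs.lie)
next
  case (diff k x z)
  then show ?case unfolding lie_diff_left by (intro lcs.diff)
qed

lemma lcs_Suc_imp_lcs: "lcs (Suc k) x \<Longrightarrow> lcs k x"
  by (induction rule: lcs_Suc_induct) (simp_all add: lcs_lie_same lcs.diff)

text \<open>The main step as a property of the index, ready for induction in steps of two. The
  \<open>itself\<close> argument carries the ring type.\<close>

definition almost_central :: "'a::ring itself \<Rightarrow> nat \<Rightarrow> bool" where
  "almost_central _ i \<longleftrightarrow>
    (\<forall>l x s :: 'a. lcs i l \<longrightarrow> lcs (Suc i) (triple (lie (x * l) s)))"

lemma almost_central_lie:
  fixes l :: "'a::ring"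
  assumes "almost_central TYPE('a) i" and "lcs i l" and "lcs k y"
  shows "lcs (Suc (i + k)) (triple (lie (x * l) y))"
  using assms(3)
proof (induction rule: lcs.induct)
  case (base y)
  then show ?case using assms(1,2) by (simp add: almost_central_def)
next
  case (lie k y z)
  have "lcs (Suc (Suc (i + k))) (lie (triple (lie (x * l) y)) z)"
    using lie.IH by (rule lcs.lie)
  moreover have "lcs (Suc (Suc i + k)) (lie (triple (lie (x * l) z)) y)"
    using assms(1,2) lie.hyps by (intro lcs_lie) (auto simp: almost_central_def)
  ultimately show ?case
    by (simp add: lie_jacobi triple_diff triple_lie lcs.diff)
next
  case (diff k y z)
  then show ?case by (simp add: lie_diff_right triple_diff lcs.diff)
qed

lemma almost_central_lie':
  fixes l :: "'a::ring"
  assumes "almost_central TYPE('a) i" and "lcs i l" and "lcs k y"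
  shows "lcs (Suc (i + k)) (triple (lie (l * x) y))"
proof -
  have "lcs (Suc (i + k)) (triple (lie (x * l) y) + triple (lie (lie l x) y))"
    using assms by (intro lcs_add lcs_triple almost_central_lie lcs_lie lcs_lie_same)
  then show ?thesis
    by (simp add: triple_def lie_def algebra_simps)
qed

lemma almost_central_2: "almost_central TYPE('a::ring) 2"
  unfolding almost_central_def
proof (intro allI impI)
  fix l x s :: 'a
  \<comment> \<open>A product of two letters counts as a single entry, so each expanded commutator
    has length four.\<close>
  interpret five_letters "lcs 3 :: 'a \<Rightarrow> bool" "\<lambda>_ _ _ _ _. True"
    by unfold_locales (auto simp: numeral_3_eq_3 intro: lcs.intros lcs_lie[where i = "Suc 0" and k = 0, simplified])
  assume "lcs 2 l"
  then have "lcs (Suc (Suc 0)) l"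
    by (simp add: numeral_2_eq_2)
  then have "lcs 3 (triple (lie (x * l) s))"
  proof (induction rule: lcs_Suc_Suc_induct)
    case (lie a b c)
    have "lcs 3 (triple (F a b c x s) - triple (lie (lie (lie (lie a b) c) x) s))"
      by (intro lcs.diff F_triple lcs_triple left_normed_5 TrueI)
    then show ?case
      by (simp add: F_def lie_def[of _ x] lie_diff_left triple_diff)
  next
    case (diff u v)
    then show ?case
      by (simp add: right_diff_distrib lie_diff_left triple_diff lcs.diff)
  qed
  then show "lcs (Suc 2) (triple (lie (x * l) s))"
    by simp
qed

lemma almost_central_add_2:
  assumes "almost_central TYPE('a::ring) i"
  shows "almost_central TYPE('a) (Suc (Suc i))"
  unfolding almost_central_def
proof (intro allI impI)
  \<comment> \<open>The factor 3 is already spent on the relations: \<open>F_triple\<close> would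
    only control \<open>9 F\<close>. Hence only the antisymmetry of \<open>F\<close> is used
    below.\<close>
  define M where "M u \<longleftrightarrow> lcs (Suc (Suc (Suc i))) (triple u)" for u :: 'a
  have lie1: "lcs (Suc i) (lie x y)" if "lcs i x \<or> lcs i y" for x y :: 'a
    using that lcs.lie lcs_lie_swap[OF _ lcs.base] by auto
  have lie2: "lcs (Suc (Suc i)) (lie (lie x y) z)" if "lcs i z" for x y z :: 'a
    using lcs_lie_swap[OF that lcs.lie[OF lcs.base]] by simp
  have lie3: "lcs (Suc (Suc (Suc i))) (lie (lie (lie x y) z) t)" if "lcs i t" for x y z t :: 'a
    using lcs_lie_swap[OF that lcs.lie[OF lcs.lie[OF lcs.base]]] by simp
  have product: "lcs (Suc (i + k)) (triple (lie (x * y) z))"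
      "lcs (Suc (i + k)) (triple (lie z (x * y)))"
    if "lcs i x \<or> lcs i y" "lcs k z" for x y z :: 'a and k
  proof -
    show *: "lcs (Suc (i + k)) (triple (lie (x * y) z))"
      using that almost_central_lie[OF assms] almost_central_lie'[OF assms] by blast
    show "lcs (Suc (i + k)) (triple (lie z (x * y)))"
      using lcs_uminus[OF *] by (simp add: triple_def lie_def algebra_simps)
  qed
  \<comment> \<open>If the distinguished letter is in the product, the hypothesis on
    \<open>i\<close> applies; otherwise the product is an ordinary entry.\<close>
  interpret five_letters M
    "\<lambda>a b c d e. lcs i a \<or> lcs i b \<or> lcs i c \<or> lcs i d \<or> lcs i e"
  proof
    fix a b c d e :: 'a
    assume Q: "lcs i a \<or> lcs i b \<or> lcs i c \<or> lcs i d \<or> lcs i e"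
    have "lcs (Suc i) (triple (lie (a * b) c))" if "lcs i a \<or> lcs i b"
      using product(1)[OF that lcs.base] by simp
    then show "M (lie (lie (lie (a * b) c) d) e)"
      using Q lcs_triple[OF lie1, of "a * b" c] lcs_triple[OF lie2, of d "a * b" c]
        lcs_triple[OF lie3, of e "a * b" c d]
      unfolding M_def triple_lie by (blast intro: lcs.lie)
    have "lcs (Suc (Suc i)) (triple (lie (lie a b) (c * d)))" if "lcs i c \<or> lcs i d"
      using product(2)[OF that lcs.lie[OF lcs.base]] by simp
    then show "M (lie (lie (lie a b) (c * d)) e)"
      using Q lcs_triple[OF lie1, of a b] lcs_triple[OF lie3, of e a b "c * d"]
      unfolding M_def triple_lie by (blast intro: lcs.lie)
    have "lcs (Suc (Suc (Suc i))) (triple (lie (lie (lie a b) c) (d * e)))"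
      if "lcs i d \<or> lcs i e"
      using product(2)[OF that lcs.lie[OF lcs.lie[OF lcs.base]]] by simp
    then show "M (lie (lie (lie a b) c) (d * e))"
      using Q lcs_triple[OF lie1, of a b] lcs_triple[OF lie2, of c a b]
      unfolding M_def triple_lie by (blast intro: lcs.lie)
  qed (auto simp: M_def triple_diff intro: lcs.diff)
  fix l x s :: 'a
  assume "lcs (Suc (Suc i)) l"
  then have "M (lie (x * l) s)"
  proof (induction rule: lcs_Suc_Suc_induct)
    case (lie l p q)
    \<comment> \<open>With \<open>l\<close> last, \<open>[q, x, p]\<close> is the element of length
      three to which \<open>almost_central_2\<close> applies.\<close>
    have "lcs (Suc (2 + i)) (triple (F q x p s l))"
      unfolding F_def using lie
      by (intro almost_central_lie'[OF almost_central_2])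
        (auto simp: numeral_2_eq_2 intro: lcs.intros)
    then have "M (F q x p s l)"
      by (simp add: M_def)
    with lie have "M (F l p q x s - F q x p s l + F q x p s l
        - lie (lie (lie (lie l p) q) x) s)"
      by (intro add diff F_move_first_last left_normed_5) auto
    then show ?case
      by (simp add: F_def lie_def[of _ x] lie_diff_left)
  next
    case (diff u v)
    then show ?case
      by (simp add: right_diff_distrib lie_diff_left five_letters.diff[OF five_letters_axioms])
  qed
  then show "lcs (Suc (Suc (Suc i))) (triple (lie (x * l) s))"
    by (simp add: M_def)
qed

lemma almost_central_even:
  assumes "even i"
  shows "almost_central TYPE('a::ring) i"
proof -
  have "almost_central TYPE('a) (2 * n)" for n
  proof (induction n)
    case 0
    show ?case
      by (simp add: almost_central_def triple_lie lcs.intros)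
  next
    case (Suc n)
    then show ?case
      using almost_central_2 almost_central_add_2[of "2 * n"] by (cases "n = 0") simp_all
  qed
  with assms show ?thesis
    by (elim evenE) simp
qed

section \<open>Products of two commutators\<close>

inductive lcs_ideal :: "nat \<Rightarrow> 'a::ring_1 \<Rightarrow> bool" for k where
  mult: "lcs k l \<Longrightarrow> lcs_ideal k (x * l)"
| diff: "lcs_ideal k u \<Longrightarrow> lcs_ideal k v \<Longrightarrow> lcs_ideal k (u - v)"

lemma lcs_imp_lcs_ideal: "lcs k l \<Longrightarrow> lcs_ideal k l"
  using lcs_ideal.mult[of k l 1] by simp

lemma lcs_ideal_add:
  assumes "lcs_ideal k u" and "lcs_ideal k v"
  shows "lcs_ideal k (u + v)"
proof -
  have "lcs_ideal k (u - (v - v - v))"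
    using assms by (intro lcs_ideal.diff)
  then show ?thesis by simp
qed

text \<open>If \<open>b\<close> has length one, it is a mere left factor. Otherwise
  \<open>[b', x] * a = x * [a, b'] - [x * a, b']\<close>, where the last term calls for even
  \<open>i\<close> and the factor 3.\<close>

lemma lcs_product_left:
  fixes a b :: "'a::ring_1"
  assumes "even i" and "lcs i a" and "lcs k b"
  shows "lcs_ideal (i + k) (triple (b * a))"
proof (cases k)
  case 0
  then show ?thesis
    using lcs_ideal.mult[OF lcs_triple, of i a b] assms(2)
    by (simp add: triple_def algebra_simps)
next
  case (Suc j)
  have "lcs_ideal (i + Suc j) (triple (b * a))"
    using assms(3) unfolding Suc
  proof (induction rule: lcs_Suc_induct)
    case (lie b' x)
    have "lcs (Suc (i + j)) (triple (lie (x * a) b'))"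
      by (rule almost_central_lie[OF almost_central_even]) (use assms lie in auto)
    moreover have "lcs (Suc (i + j)) (triple (lie a b'))"
      using assms lie by (intro lcs_triple lcs_lie)
    ultimately have "lcs_ideal (Suc (i + j)) (x * triple (lie a b') - triple (lie (x * a) b'))"
      by (intro lcs_ideal.intros lcs_imp_lcs_ideal)
    then show ?case
      by (simp add: triple_def lie_def algebra_simps)
  next
    case (diff u v)
    then show ?case
      by (simp add: left_diff_distrib triple_diff lcs_ideal.diff)
  qed
  with Suc show ?thesis by simp
qed

lemma lcs_product_right:
  fixes a b :: "'a::ring_1"
  assumes "even i" and "lcs i a" and "lcs k b"
  shows "lcs_ideal (i + k) (triple (a * b))"
proof -
  have "lcs (i + k) (lie a b)"
    using lcs_Suc_imp_lcs[OF lcs_lie] assms by blast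
  then have "lcs_ideal (i + k) (triple (b * a) + triple (lie a b))"
    using assms by (intro lcs_ideal_add lcs_product_left lcs_imp_lcs_ideal lcs_triple)
  then show ?thesis
    by (simp add: triple_def lie_def algebra_simps)
qed

section \<open>The free ring\<close>

text \<open>The free ring is an instance of the type class, so the result holds in it, and evaluation
  carries it over to a ring given by a carrier set.\<close>

datatype 'v ring_term =
  Var 'v | Zero | One | Plus "'v ring_term" "'v ring_term"
  | Minus "'v ring_term" | Times "'v ring_term" "'v ring_term"

inductive ring_equiv :: "'v ring_term \<Rightarrow> 'v ring_term \<Rightarrow> bool" where
  refl: "ring_equiv s s"
| sym: "ring_equiv s t \<Longrightarrow> ring_equiv t s"
| trans: "ring_equiv s t \<Longrightarrow> ring_equiv t u \<Longrightarrow> ring_equiv s u"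
| Plus_cong: "ring_equiv s s' \<Longrightarrow> ring_equiv t t' \<Longrightarrow> ring_equiv (Plus s t) (Plus s' t')"
| Minus_cong: "ring_equiv s s' \<Longrightarrow> ring_equiv (Minus s) (Minus s')"
| Times_cong: "ring_equiv s s' \<Longrightarrow> ring_equiv t t' \<Longrightarrow> ring_equiv (Times s t) (Times s' t')"
| Plus_assoc: "ring_equiv (Plus (Plus s t) u) (Plus s (Plus t u))"
| Plus_commute: "ring_equiv (Plus s t) (Plus t s)"
| Plus_Zero: "ring_equiv (Plus Zero s) s"
| Plus_Minus: "ring_equiv (Plus (Minus s) s) Zero"
| Times_assoc: "ring_equiv (Times (Times s t) u) (Times s (Times t u))"
| Times_One_left: "ring_equiv (Times One s) s"
| Times_One_right: "ring_equiv (Times s One) s"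
| distrib_right: "ring_equiv (Times (Plus s t) u) (Plus (Times s u) (Times t u))"
| distrib_left: "ring_equiv (Times s (Plus t u)) (Plus (Times s t) (Times s u))"

context ring
begin

text \<open>Letters outside the carrier are sent to zero, so that every assignment is admissible.\<close>

fun term_value :: "('v \<Rightarrow> 'a) \<Rightarrow> 'v ring_term \<Rightarrow> 'a" where
  "term_value f (Var v) = (if f v \<in> carrier R then f v else \<zero>)"
| "term_value f Zero = \<zero>"
| "term_value f One = \<one>"
| "term_value f (Plus s t) = term_value f s \<oplus> term_value f t"
| "term_value f (Minus s) = \<ominus> term_value f s"
| "term_value f (Times s t) = term_value f s \<otimes> term_value f t"

lemma term_value_closed [simp]: "term_value f s \<in> carrier R"
  by (induction s) simp_all

lemma term_value_cong: "ring_equiv s t \<Longrightarrow> term_value f s = term_value f t"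
  by (induction rule: ring_equiv.induct) (simp_all add: a_ac m_assoc r_neg l_distr r_distr)

end

quotient_type 'v free_ring = "'v ring_term" / ring_equiv
  by (rule equivpI) (auto intro!: reflpI sympI transpI intro: ring_equiv.intros(1-3))

instantiation free_ring :: (type) ring_1
begin

lift_definition zero_free_ring :: "'a free_ring" is Zero .
lift_definition one_free_ring :: "'a free_ring" is One .
lift_definition plus_free_ring :: "'a free_ring \<Rightarrow> 'a free_ring \<Rightarrow> 'a free_ring" is Plus
  by (rule ring_equiv.Plus_cong)
lift_definition uminus_free_ring :: "'a free_ring \<Rightarrow> 'a free_ring" is Minus
  by (rule ring_equiv.Minus_cong)
lift_definition minus_free_ring :: "'a free_ring \<Rightarrow> 'a free_ring \<Rightarrow> 'a free_ring"
  is "\<lambda>s t. Plus s (Minus t)"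
  by (intro ring_equiv.Plus_cong ring_equiv.Minus_cong)
lift_definition times_free_ring :: "'a free_ring \<Rightarrow> 'a free_ring \<Rightarrow> 'a free_ring" is Times
  by (rule ring_equiv.Times_cong)

instance
proof
  \<comment> \<open>Evaluation in the integers separates 0 from 1.\<close>
  interpret int: ring int_ring
    by (rule int_is_cring[THEN cring.axioms(1)])
  show "(0 :: 'a free_ring) \<noteq> 1"
  proof (transfer, rule notI)
    assume "ring_equiv (Zero :: 'a ring_term) One"
    from int.term_value_cong[OF this, of "\<lambda>_. 0"] show False
      by simp
  qed
qed (transfer; auto intro: ring_equiv.intros)+

end

context ring
begin

lift_definition free_value :: "('v \<Rightarrow> 'a) \<Rightarrow> 'v free_ring \<Rightarrow> 'a" is term_value
  by (rule term_value_cong)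

lemma free_value_closed [simp]: "free_value f x \<in> carrier R"
  by transfer simp

lemma free_value_add: "free_value f (x + y) = free_value f x \<oplus> free_value f y"
  and free_value_diff: "free_value f (x - y) = free_value f x \<ominus> free_value f y"
  and free_value_mult: "free_value f (x * y) = free_value f x \<otimes> free_value f y"
  by (transfer; simp add: a_minus_def)+

lemma free_value_lie:
  "free_value f (lie x y) = commutator R (free_value f x) (free_value f y)"
  by (simp add: lie_def commutator_def free_value_diff free_value_mult)

lemma free_value_triple: "free_value f (triple x) = [(3::nat)] \<cdot> free_value f x"
  by (simp add: triple_def free_value_add numeral_3_eq_3 a_ac)

end

lift_definition letter :: "'v \<Rightarrow> 'v free_ring" is Var .

lemma (in ring) free_value_letter: "f v \<in> carrier R \<Longrightarrow> free_value f (letter v) = f v"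
  by transfer simp

section \<open>Evaluation in an arbitrary ring\<close>

text \<open>Counterpart of \<open>lcs\<close> over a carrier set; here \<open>k\<close> is the
  length itself, without the shift.\<close>

inductive_set left_normed_span :: "('a, 'b) ring_scheme \<Rightarrow> nat \<Rightarrow> 'a set"
  for R (structure) and k where
  left_normed: "a \<in> {1..k} \<rightarrow> carrier R \<Longrightarrow> left_normed R a k \<in> left_normed_span R k"
| diff: "x \<in> left_normed_span R k \<Longrightarrow> y \<in> left_normed_span R k
    \<Longrightarrow> x \<ominus> y \<in> left_normed_span R k"

lemma left_normed_cong:
  "(\<And>i. i \<in> {1..k} \<Longrightarrow> a i = b i) \<Longrightarrow> left_normed R a k = left_normed R b k"
  by (induction R a k rule: left_normed.induct) auto

context ring
begin

lemma commutator_closed [simp]: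
  "x \<in> carrier R \<Longrightarrow> y \<in> carrier R \<Longrightarrow> commutator R x y \<in> carrier R"
  by (simp add: commutator_def)

lemma commutator_diff:
  assumes "x \<in> carrier R" and "y \<in> carrier R" and "z \<in> carrier R"
  shows "commutator R (x \<ominus> y) z = commutator R x z \<ominus> commutator R y z"
  using assms
  by (simp add: commutator_def a_minus_def l_distr r_distr l_minus r_minus minus_add a_ac)

lemma left_normed_closed: "a \<in> {1..k} \<rightarrow> carrier R \<Longrightarrow> left_normed R a k \<in> carrier R"
proof (induction k)
  case (Suc k)
  then show ?case by (cases k) (auto simp: Pi_iff)
qed simp

lemma left_normed_span_closed: "x \<in> left_normed_span R k \<Longrightarrow> x \<in> carrier R"
  by (induction rule: left_normed_span.induct) (simp_all add: left_normed_closed)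

lemma commutator_left_normed_span:
  assumes "x \<in> left_normed_span R (Suc k)" and "y \<in> carrier R"
  shows "commutator R x y \<in> left_normed_span R (Suc (Suc k))"
  using assms(1)
proof (induction rule: left_normed_span.induct)
  case (left_normed a)
  let ?a = "a(Suc (Suc k) := y)"
  have "left_normed R ?a (Suc k) = left_normed R a (Suc k)"
    by (rule left_normed_cong) simp
  then have "commutator R (left_normed R a (Suc k)) y = left_normed R ?a (Suc (Suc k))"
    by simp
  moreover have "?a \<in> {1..Suc (Suc k)} \<rightarrow> carrier R"
    using left_normed assms(2) by (auto simp: Pi_iff)
  ultimately show ?case
    by (simp only: left_normed_span.left_normed)
next
  case (diff u v)
  then show ?case
    using assms(2) by (simp add: commutator_diff left_normed_span_closed left_normed_span.diff)
qed

lemma free_value_lcs: "lcs k x \<Longrightarrow> free_value f x \<in> left_normed_span R (Suc k)"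
proof (induction rule: lcs.induct)
  case (base x)
  then show ?case
    using left_normed_span.left_normed[of "\<lambda>_. free_value f x" "Suc 0" R] by simp
next
  case (lie k x y)
  then show ?case by (simp add: free_value_lie commutator_left_normed_span)
next
  case (diff k x y)
  then show ?case by (simp add: free_value_diff left_normed_span.diff)
qed

lemma ideal_T_ideal: "ideal (T_ideal R k) R"
  unfolding T_ideal_def by (rule genideal_ideal) (blast intro: left_normed_closed)

lemma T_ideal_diff:
  assumes "x \<in> T_ideal R k" and "y \<in> T_ideal R k"
  shows "x \<ominus> y \<in> T_ideal R k"
proof -
  interpret ideal "T_ideal R k" R
    by (rule ideal_T_ideal)
  show ?thesis
    using assms by (simp add: a_minus_def)
qed

lemma left_normed_span_T_ideal: "x \<in> left_normed_span R k \<Longrightarrow> x \<in> T_ideal R k"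
proof (induction rule: left_normed_span.induct)
  case (left_normed a)
  have "{left_normed R a k | a. a \<in> {1..k} \<rightarrow> carrier R} \<subseteq> carrier R"
    by (blast intro: left_normed_closed)
  then show ?case
    unfolding T_ideal_def using left_normed genideal_self by blast
next
  case (diff u v)
  then show ?case by (simp add: T_ideal_diff)
qed

lemma free_value_lcs_ideal: "lcs_ideal k x \<Longrightarrow> free_value f x \<in> T_ideal R (Suc k)"
proof (induction rule: lcs_ideal.induct)
  case (mult l x)
  then show ?case
    using ideal.I_l_closed[OF ideal_T_ideal]
    by (simp add: free_value_mult free_value_lcs left_normed_span_T_ideal)
next
  case (diff u v)
  then show ?case by (simp add: free_value_diff T_ideal_diff)
qed

text \<open>The letters are the ring elements themselves, so the identity assignment evaluates the
  same commutator of letters to the given one.\<close>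

lemma left_normed_lift:
  assumes "a \<in> {1..Suc k} \<rightarrow> carrier R"
  obtains x where "lcs k x" and "free_value (\<lambda>v. v) x = left_normed R a (Suc k)"
proof -
  from assms have "\<exists>x. lcs k x \<and> free_value (\<lambda>v. v) x = left_normed R a (Suc k)"
  proof (induction k)
    case 0
    then show ?case
      by (intro exI[of _ "letter (a 1)"]) (auto simp: free_value_letter intro: lcs.base)
  next
    case (Suc k)
    from Suc.prems have "a \<in> {1..Suc k} \<rightarrow> carrier R"
      by auto
    with Suc.IH obtain x where x: "lcs k x" "free_value (\<lambda>v. v) x = left_normed R a (Suc k)"
      by blast
    moreover have "a (Suc (Suc k)) \<in> carrier R"
      using Suc.prems by auto
    ultimately show ?case
      by (intro exI[of _ "lie x (letter (a (Suc (Suc k))))"])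
        (simp add: free_value_lie free_value_letter lcs.lie)
  qed
  with that show ?thesis by blast
qed

end

theorem theorem1p1:
  fixes R (structure) and m n :: nat and a b :: "nat \<Rightarrow> 'a"
  assumes "ring R"
    and "m \<ge> 1" and "n \<ge> 1"
    and "odd m \<or> odd n"
    and "a \<in> {1..m} \<rightarrow> carrier R" and "b \<in> {1..n} \<rightarrow> carrier R"
  shows "[(3::nat)] \<cdot> (left_normed R a m \<otimes> left_normed R b n) \<in> T_ideal R (m + n - 1)"
proof -
  interpret ring R
    by (rule assms(1))
  obtain i k where ik: "m = Suc i" "n = Suc k"
    using assms(2,3) by (cases m; cases n) auto
  obtain x where x: "lcs i x" "free_value (\<lambda>v. v) x = left_normed R a m"
    using left_normed_lift assms(5) unfolding ik by blast
  obtain y where y: "lcs k y" "free_value (\<lambda>v. v) y = left_normed R b n"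
    using left_normed_lift assms(6) unfolding ik by blast
  \<comment> \<open>Odd length is even index, so the factor of odd length takes the role of
    \<open>a\<close> in the product lemmas.\<close>
  have "lcs_ideal (i + k) (triple (x * y))"
    using assms(4) lcs_product_right[of i x k y] lcs_product_left[of k y i x] x(1) y(1) ik
    by (auto simp: add.commute)
  from free_value_lcs_ideal[OF this, of "\<lambda>v. v"] show ?thesis
    by (simp add: free_value_triple free_value_mult x(2) y(2) ik)
qed

end
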